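(* Let $K\subset\mathbb{R}^3$ be a polygonal knot. Let $\mathcal{A}$ be the set of knot types that arise as $\hat\rho(K)$, where $\rho$ ranges over all single sphere inversions whose center is not a vertex of $K$ and for which $\hat\rho(K)$ is an embedded polygon. Let $\mathcal{M}$ be the set of knot types that arise as $\hat\mu(K)$, where $\mu$ ranges over all M\"obius transformations taking no vertex of $K$ to $\infty$ and for which $\hat\mu(K)$ is an embedded polygon. Then $$|\mathcal{M}|\le 2\,|\mathcal{A}|.$$ Specifically, whenever $\hat\rho(K)$ is an embedded polygon for a single inversion $\rho$, there is a further inversion $\sigma$ such that $\widehat{\sigma\circ\rho}(K)$ has the knot type of the mirror image of $\hat\rho(K)$; and every knot type in $\mathcal{M}$ either is in $\mathcal{A}$ or is the mirror image of a knot type in $\mathcal{A}$.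
   Context: A polygonal knot with $n$ edges is a simple closed polygon in $\mathbb{R}^3$ with a cyclically ordered list of vertices $v_1,\dots,v_n$ and edges the segments $[v_i,v_{i+1}]$ (indices mod $n$). Knot type means ambient isotopy class of (unoriented) knots in $\mathbb{R}^3$; mirror images are distinguished. For $\mathbf{p}\in\mathbb{R}^3$, $r>0$, inversion in the sphere of radius $r$ centered at $\mathbf{p}$ is the map of $\mathbb{R}^3\cup\{\infty\}$ given by $\rho[\mathbf{p},r](\mathbf{x})=\mathbf{p}+\frac{r^2(\mathbf{x}-\mathbf{p})}{|\mathbf{x}-\mathbf{p}|^2}$, with $\mathbf{p}\leftrightarrow\infty$. Planes are regarded as spheres through $\infty$, and reflections in planes are included as inversions. A M\"obius transformation means here any finite composition (of an even or odd number) of inversions, so orientation-reversing maps are included. If $\mu$ is a M\"obius transformation taking no vertex of $K$ to $\infty$, then $\hat\mu(K)$ is the closed polygon with successive vertices $\mu(v_1),\dots,\mu(v_n)$ connected by straight line segments; this includes the case of a single inversion $\hat\rho(K)$. The polygon may be self-intersecting; it has a knot type only when it is embedded. *)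

theory Defs
  imports "HOL-Analysis.Analysis" "HOL-Library.Equipollence"
begin

section \<open>Closed polygons and polygonal knots\<close>

text \<open>
  A closed polygon is given by the list of its successive vertices; the last vertex is joined
  to the first one.
\<close>

definition polygon_edge :: "(real^3) list \<Rightarrow> nat \<Rightarrow> (real^3) set" where
  "polygon_edge vs i = closed_segment (vs ! i) (vs ! (Suc i mod length vs))"

definition polygon :: "(real^3) list \<Rightarrow> (real^3) set" where
  "polygon vs = (\<Union>i<length vs. polygon_edge vs i)"

text \<open>
  Simple closed polygons: two different edges meet exactly in the vertices they have in common,
  that is, in one point if they are adjacent and not at all otherwise.  Consecutive collinear
  edges are allowed as long as they do not overlap.
\<close>

definition embedded_polygon :: "(real^3) list \<Rightarrow> bool" where
  "embedded_polygon vs \<longleftrightarrow> 3 \<le> length vs \<and> distinct vs \<and>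
     (\<forall>i<length vs. \<forall>j<length vs. i \<noteq> j \<longrightarrow>
        polygon_edge vs i \<inter> polygon_edge vs j =
        {vs ! i, vs ! (Suc i mod length vs)} \<inter> {vs ! j, vs ! (Suc j mod length vs)})"

section \<open>Knot types\<close>

definition ambient_isotopic :: "(real^3) set \<Rightarrow> (real^3) set \<Rightarrow> bool" where
  "ambient_isotopic K L \<longleftrightarrow>
     (\<exists>h. homotopic_with (homeomorphic_map euclidean euclidean) euclidean euclidean id h \<and>
          h ` K = L)"

text \<open>Knots are treated as point sets, hence are unoriented.\<close>

definition knot_type :: "(real^3) set \<Rightarrow> (real^3) set set" where
  "knot_type K = {L. ambient_isotopic K L}"

text \<open>Reflection in the plane of all \<open>x\<close> with \<open>a \<bullet> x = b\<close>, for \<open>a \<noteq> 0\<close>.\<close>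

definition reflection :: "real^3 \<Rightarrow> real \<Rightarrow> real^3 \<Rightarrow> real^3" where
  "reflection a b x = x - (2 * (a \<bullet> x - b) / (a \<bullet> a)) *\<^sub>R a"

text \<open>
  The mirror image is taken in one fixed coordinate plane; up to ambient isotopy the choice of
  the plane is irrelevant.
\<close>

definition mirror :: "(real^3) set \<Rightarrow> (real^3) set" where
  "mirror K = reflection (axis 3 1) 0 ` K"

definition mirror_type :: "(real^3) set set \<Rightarrow> (real^3) set set" where
  "mirror_type T = mirror ` T"

section \<open>Inversions and Moebius transformations\<close>

text \<open>The type \<open>(real^3) option\<close> is three-space with a point at infinity, which is \<open>None\<close>.\<close>

definition sphere_inversion :: "real^3 \<Rightarrow> real \<Rightarrow> (real^3) option \<Rightarrow> (real^3) option" where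
  "sphere_inversion p r z =
     (case z of
        None \<Rightarrow> Some p
      | Some x \<Rightarrow> if x = p then None
                  else Some (p + (r\<^sup>2 / (norm (x - p))\<^sup>2) *\<^sub>R (x - p)))"

definition plane_inversion :: "real^3 \<Rightarrow> real \<Rightarrow> (real^3) option \<Rightarrow> (real^3) option" where
  "plane_inversion a b = map_option (reflection a b)"

text \<open>Planes count as spheres through infinity.\<close>

definition is_inversion :: "((real^3) option \<Rightarrow> (real^3) option) \<Rightarrow> bool" where
  "is_inversion \<rho> \<longleftrightarrow>
     (\<exists>p r. r > 0 \<and> \<rho> = sphere_inversion p r) \<or> (\<exists>a b. a \<noteq> 0 \<and> \<rho> = plane_inversion a b)"

text \<open>
  The centre of an inversion is the point exchanged with infinity: \<open>Some p\<close> for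
  \<open>sphere_inversion p r\<close>, and infinity itself for the reflection in a plane.
\<close>

definition inversion_center :: "((real^3) option \<Rightarrow> (real^3) option) \<Rightarrow> (real^3) option" where
  "inversion_center \<rho> = \<rho> None"

inductive is_moebius :: "((real^3) option \<Rightarrow> (real^3) option) \<Rightarrow> bool" where
  moebius_id: "is_moebius id"
| moebius_comp: "is_inversion \<rho> \<Longrightarrow> is_moebius \<mu> \<Longrightarrow> is_moebius (\<rho> \<circ> \<mu>)"

section \<open>Transforming the vertices of a polygon\<close>

definition no_vertex_to_infinity ::
    "((real^3) option \<Rightarrow> (real^3) option) \<Rightarrow> (real^3) list \<Rightarrow> bool" where
  "no_vertex_to_infinity \<mu> vs \<longleftrightarrow> (\<forall>v\<in>set vs. \<mu> (Some v) \<noteq> None)"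

text \<open>Only meaningful if \<open>\<mu>\<close> takes no vertex to infinity.\<close>

definition hat :: "((real^3) option \<Rightarrow> (real^3) option) \<Rightarrow> (real^3) list \<Rightarrow> (real^3) list" where
  "hat \<mu> vs = map (\<lambda>v. the (\<mu> (Some v))) vs"

definition inversion_types :: "(real^3) list \<Rightarrow> (real^3) set set set" where
  "inversion_types vs =
     {knot_type (polygon (hat \<rho> vs)) | \<rho>.
        is_inversion \<rho> \<and> inversion_center \<rho> \<notin> Some ` set vs \<and> embedded_polygon (hat \<rho> vs)}"

definition moebius_types :: "(real^3) list \<Rightarrow> (real^3) set set set" where
  "moebius_types vs =
     {knot_type (polygon (hat \<mu> vs)) | \<mu>.
        is_moebius \<mu> \<and> no_vertex_to_infinity \<mu> vs \<and> embedded_polygon (hat \<mu> vs)}"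

end

theory Submission
  imports Defs
begin

text \<open>
  A Moebius transformation that fixes infinity is a similarity, so one that takes \<open>p\<close> to infinity
  is a similarity after the inversion in the unit sphere about \<open>p\<close>.  A similarity acts on straight
  polygons pointwise and is isotopic to the identity or to the fixed mirror reflection: its
  orthogonal part is a product of reflections in planes, and these are all isotopic to each other
  because their normal vectors form the connected set of nonzero vectors.  In particular, a
  reflection in a plane serves as \<open>\<sigma>\<close>.
\<close>

section \<open>Isotopies of three-space\<close>

abbreviation homeo :: "(real^3 \<Rightarrow> real^3) \<Rightarrow> bool" where
  "homeo \<equiv> homeomorphic_map euclidean euclidean"

definition isotopic :: "(real^3 \<Rightarrow> real^3) \<Rightarrow> (real^3 \<Rightarrow> real^3) \<Rightarrow> bool" where
  "isotopic = homotopic_with homeo euclidean euclidean"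

lemma homeo_continuous: "homeo f \<Longrightarrow> continuous_map euclidean euclidean f"
  by (rule homeomorphic_imp_continuous_map)

lemma homeo_inverse:
  assumes "homeo f"
  obtains g where "homeo g" "g \<circ> f = id" "f \<circ> g = id"
proof -
  obtain g where g: "homeomorphic_maps euclidean euclidean f g"
    using assms homeomorphic_map_maps by blast
  then have "homeo g"
    using homeomorphic_map_maps homeomorphic_maps_sym by blast
  with g show thesis
    by (intro that) (auto simp: homeomorphic_maps_def fun_eq_iff)
qed

lemma isotopicI:
  assumes "continuous_on ({0..1} \<times> UNIV) (\<lambda>(t, x). h t x)"
    and "\<And>t. t \<in> {0..1} \<Longrightarrow> homeo (h t)"
  shows "isotopic (h (0::real)) (h 1)"
  unfolding isotopic_def homotopic_with_def
proof (intro exI conjI allI ballI)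
  \<comment> \<open>\<open>homotopic_with\<close> is stated with product topologies, while
    \<open>continuous_on\<close> uses the product type; both give the same topology on [0,1] times
    space.\<close>
  have "prod_topology (top_of_set {0..1}) (euclidean :: (real^3) topology)
          = top_of_set ({0..1::real} \<times> UNIV)"
    using prod_topology_subtopology_eu[of "{0..1::real}" "UNIV :: (real^3) set"] by simp
  then show "continuous_map (prod_topology (top_of_set {0..1}) euclidean) euclidean (\<lambda>(t, x). h t x)"
    using assms(1) by simp
qed (simp_all add: assms(2))

lemma isotopic_homeo: "isotopic f g \<Longrightarrow> homeo f \<and> homeo g"
  unfolding isotopic_def by (rule homotopic_with_imp_property[where P = homeo])

lemma isotopic_refl: "homeo f \<Longrightarrow> isotopic f f"
  unfolding isotopic_def homotopic_with_refl by (blast intro: homeo_continuous)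

lemma isotopic_sym: "isotopic f g \<Longrightarrow> isotopic g f"
  unfolding isotopic_def by (rule homotopic_with_symD)

lemma isotopic_trans [trans]: "isotopic f g \<Longrightarrow> isotopic g h \<Longrightarrow> isotopic f h"
  unfolding isotopic_def by (rule homotopic_with_trans)

lemma isotopic_comp_left: "isotopic f g \<Longrightarrow> homeo h \<Longrightarrow> isotopic (h \<circ> f) (h \<circ> g)"
  unfolding isotopic_def
  by (erule homotopic_with_compose_continuous_map_left)
     (blast intro: homeo_continuous homeomorphic_map_compose)+

lemma isotopic_comp_right: "isotopic f g \<Longrightarrow> homeo h \<Longrightarrow> isotopic (f \<circ> h) (g \<circ> h)"
  unfolding isotopic_def
  by (erule homotopic_with_compose_continuous_map_right)
     (blast intro: homeo_continuous homeomorphic_map_compose)+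

section \<open>Ambient isotopy as an equivalence relation on point sets\<close>

lemma ambient_isotopic_iff: "ambient_isotopic K L \<longleftrightarrow> (\<exists>h. isotopic id h \<and> h ` K = L)"
  by (simp add: ambient_isotopic_def isotopic_def)

lemma ambient_isotopic_refl: "ambient_isotopic K K"
  unfolding ambient_isotopic_iff by (metis homeomorphic_map_id image_id isotopic_refl id_apply)

text \<open>Composing the isotopy from \<open>id\<close> to \<open>h\<close> on the right with the
  inverse \<open>g\<close> of its end map yields one from \<open>g\<close> to \<open>id\<close>, so
  the inverses of the intermediate homeomorphisms never enter.\<close>

lemma ambient_isotopic_sym:
  assumes "ambient_isotopic K L" shows "ambient_isotopic L K"
proof -
  obtain h where h: "isotopic id h" "h ` K = L"
    using assms by (auto simp: ambient_isotopic_iff)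
  then obtain g where g: "homeo g" "g \<circ> h = id" "h \<circ> g = id"
    using homeo_inverse isotopic_homeo by metis
  have "isotopic g id"
    using isotopic_comp_right[OF h(1) g(1)] g(3) by simp
  moreover have "g ` L = K"
    using h(2) g(2) by (metis image_comp image_id id_apply)
  ultimately show ?thesis
    using isotopic_sym by (auto simp: ambient_isotopic_iff)
qed

lemma ambient_isotopic_trans:
  assumes "ambient_isotopic K L" "ambient_isotopic L M" shows "ambient_isotopic K M"
proof -
  obtain h g where h: "isotopic id h" "h ` K = L" and g: "isotopic id g" "g ` L = M"
    using assms by (auto simp: ambient_isotopic_iff)
  have "isotopic id (g \<circ> h)"
    using isotopic_trans[OF h(1)] isotopic_comp_right[OF g(1)] isotopic_homeo[OF h(1)] by simp
  moreover have "(g \<circ> h) ` K = M"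
    using h g by (metis image_comp)
  ultimately show ?thesis
    by (auto simp: ambient_isotopic_iff)
qed

lemma knot_type_eq_iff: "knot_type K = knot_type L \<longleftrightarrow> ambient_isotopic K L"
  unfolding knot_type_def using ambient_isotopic_refl ambient_isotopic_sym ambient_isotopic_trans
  by (metis mem_Collect_eq subsetI subset_antisym)

text \<open>With \<open>f'\<close> the inverse of \<open>f\<close>, the map
  \<open>g \<circ> f'\<close> is isotopic to the identity and carries \<open>f\<close>
  K\<open>onto\<close>g \<open>K\<close>.\<close>

lemma knot_type_image:
  assumes "isotopic f g"
  shows "knot_type (f ` K) = knot_type (g ` K)"
proof -
  obtain f' where f': "homeo f'" "f' \<circ> f = id" "f \<circ> f' = id"
    using homeo_inverse isotopic_homeo assms by metis
  have "isotopic id (g \<circ> f')"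
    using isotopic_comp_right[OF assms f'(1)] f'(3) by simp
  moreover have "(g \<circ> f') ` f ` K = g ` K"
    using f'(2) by (metis comp_id image_comp comp_assoc)
  ultimately show ?thesis
    unfolding knot_type_eq_iff ambient_isotopic_iff by blast
qed

section \<open>Reflections and similarities\<close>

abbreviation mir :: "real^3 \<Rightarrow> real^3" where
  "mir \<equiv> reflection (axis 3 1) 0"

lemma reflection_involution [simp]: "reflection a b (reflection a b x) = x"
  \<comment> \<open>For \<open>a = 0\<close> the subtracted multiple of \<open>a\<close> vanishes
    and the formula gives the identity, whatever the quotient by zero is.\<close>
  by (cases "a = 0")
     (simp_all add: reflection_def inner_diff_right diff_divide_distrib right_diff_distrib
        scaleR_diff_left)

lemma reflection_inner: "reflection a 0 x \<bullet> reflection a 0 y = x \<bullet> y"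
  by (cases "a = 0") (simp_all add: reflection_def inner_diff_right inner_diff_left inner_commute field_simps)

lemma reflection_diff: "reflection a b x - reflection a b y = reflection a 0 (x - y)"
  by (simp add: reflection_def inner_diff_right algebra_simps diff_divide_distrib flip: scaleR_add_left)

lemma dist_reflection: "dist (reflection a b x) (reflection a b y) = dist x y"
  by (simp add: dist_norm reflection_diff norm_eq_sqrt_inner reflection_inner)

lemma linear_reflection: "linear (reflection a 0)"
  by (rule linearI) (simp_all add: reflection_def inner_add_right algebra_simps add_divide_distrib)

lemma orthogonal_transformation_reflection: "orthogonal_transformation (reflection a 0)"
  by (simp add: orthogonal_transformation_def linear_reflection reflection_inner)

lemma homeo_reflection: "homeo (reflection a 0)"
  by (rule homeomorphic_map_involution) (auto simp: linear_continuous_on linear_conv_bounded_linear[symmetric] linear_reflection)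

text \<open>In dimension at least 2 the complement of the origin is path connected. A path of normal
  vectors in it gives a path of reflections, and since it avoids \<open>0\<close>, the division by
  the squared length of the normal stays continuous.\<close>

lemma isotopic_reflections:
  assumes "a \<noteq> 0" "b \<noteq> 0"
  shows "isotopic (reflection a 0) (reflection b 0)"
proof -
  have "path_connected (- {0::real^3})"
    by (rule path_connected_punctured_universe) simp
  then have "\<exists>g. path g \<and> path_image g \<subseteq> - {0} \<and> pathstart g = a \<and> pathfinish g = b"
    using assms unfolding path_connected_def by simp
  then obtain g where g: "path g" "path_image g \<subseteq> - {0}" "g 0 = a" "g 1 = b"
    unfolding pathstart_def pathfinish_def by blast
  have cont: "continuous_on ({0..1} \<times> UNIV) (\<lambda>z::real \<times> (real^3). g (fst z))"
    by (rule continuous_on_compose2[OF g(1)[unfolded path_def]]) (auto intro!: continuous_intros)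
  have nz: "g t \<noteq> 0" if "t \<in> {0..1}" for t
    using g(2) that by (auto simp: path_image_def)
  have "isotopic (reflection (g 0) 0) (reflection (g 1) 0)"
  proof (rule isotopicI[where h = "\<lambda>t. reflection (g t) 0"])
    show "continuous_on ({0..1} \<times> UNIV) (\<lambda>(t, x). reflection (g t) 0 x)"
      unfolding reflection_def case_prod_unfold
      by (intro continuous_intros cont) (use nz in auto)
  qed (rule homeo_reflection)
  then show ?thesis
    using g by simp
qed

text \<open>Stands in for preserving or reversing orientation: knot types depend on the isotopy
  class of a map, so no determinant is tracked.\<close>

definition id_or_mirror :: "(real^3 \<Rightarrow> real^3) \<Rightarrow> bool" where
  "id_or_mirror f \<longleftrightarrow> isotopic f id \<or> isotopic f mir"

text \<open>Every reflection is isotopic to \<open>mir\<close>, and \<open>mir\<close> is an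
  involution, so composing with a reflection exchanges the two alternatives.\<close>

lemma id_or_mirror_reflection:
  assumes "a \<noteq> 0" "id_or_mirror f"
  shows "id_or_mirror (reflection a 0 \<circ> f)"
proof -
  have a: "isotopic (reflection a 0) mir"
    by (intro isotopic_reflections assms) (simp add: axis_eq_0_iff)
  consider "isotopic f id" | "isotopic f mir"
    using assms by (auto simp: id_or_mirror_def)
  then show ?thesis
  proof cases
    case 1
    have "isotopic (reflection a 0 \<circ> f) (reflection a 0 \<circ> id)"
      by (intro isotopic_comp_left 1 homeo_reflection)
    also have "reflection a 0 \<circ> id = reflection a 0"
      by simp
    also note a
    finally show ?thesis
      unfolding id_or_mirror_def ..
  next
    case 2
    have "isotopic (reflection a 0 \<circ> f) (reflection a 0 \<circ> mir)"
      by (intro isotopic_comp_left 2 homeo_reflection)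
    also have "isotopic \<dots> (mir \<circ> mir)"
      by (intro isotopic_comp_right a homeo_reflection)
    also have "mir \<circ> mir = id"
      by (auto simp: fun_eq_iff)
    finally show ?thesis
      unfolding id_or_mirror_def ..
  qed
qed

text \<open>If \<open>Q\<close> moves the basis vector \<open>e\<close>, then the reflection along \<open>Q e - e\<close> takes \<open>Q e\<close>
  back to \<open>e\<close> and keeps every basis vector that \<open>Q\<close> fixes.\<close>

lemma orthogonal_id_or_mirror:
  assumes "orthogonal_transformation Q"
  shows "id_or_mirror Q"
  using assms
proof (induction "card {e \<in> Basis. Q e \<noteq> e}" arbitrary: Q rule: less_induct)
  case less
  show ?case
  proof (cases "\<exists>e\<in>Basis. Q e \<noteq> e")
    case False
    then have "Q = id"
      using less.prems linear_eq_stdbasis[of Q id]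
      by (auto simp: orthogonal_transformation_def linear_id)
    then show ?thesis
      by (simp add: id_or_mirror_def isotopic_refl)
  next
    case True
    then obtain e where e: "e \<in> Basis" "Q e \<noteq> e" by blast
    define a where "a = Q e - e"
    have a: "a \<noteq> 0" using e by (simp add: a_def)
    have QQ: "Q v \<bullet> Q w = v \<bullet> w" for v w
      using less.prems by (simp add: orthogonal_transformation_def)
    let ?P = "reflection a 0 \<circ> Q"
    \<comment> \<open>Because \<open>Q e\<close> and \<open>e\<close> have the same length; hence
      the reflection subtracts from \<open>Q e\<close> exactly \<open>a\<close>, leaving
      \<open>e\<close>.\<close>
    have "a \<bullet> a = 2 * (a \<bullet> Q e)"
      using QQ[of e e] by (simp add: a_def inner_diff_left inner_diff_right inner_commute)
    moreover have "a \<bullet> a \<noteq> 0"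
      using a by simp
    ultimately have coeff: "2 * (a \<bullet> Q e) / (a \<bullet> a) = 1"
      by (metis divide_self)
    have "?P e = Q e - (2 * (a \<bullet> Q e) / (a \<bullet> a)) *\<^sub>R a"
      by (simp add: reflection_def)
    also have "\<dots> = e"
      unfolding coeff by (simp add: a_def)
    finally have Pe: "?P e = e" .
    have P: "?P f = f" if "f \<in> Basis" "Q f = f" for f
    proof -
      \<comment> \<open>\<open>Q e\<close> and \<open>e\<close> have the same inner product with
        \<open>f\<close>, since \<open>Q f = f\<close>; so \<open>f\<close> lies in the reflecting
        plane.\<close>
      have "a \<bullet> f = 0"
        using QQ[of e f] that by (simp add: a_def inner_diff_left)
      then show ?thesis using that by (simp add: reflection_def)
    qed
    have "{e \<in> Basis. ?P e \<noteq> e} \<subset> {e \<in> Basis. Q e \<noteq> e}"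
      using P Pe e by blast
    then have "card {e \<in> Basis. ?P e \<noteq> e} < card {e \<in> Basis. Q e \<noteq> e}"
      by (intro psubset_card_mono) auto
    then have "id_or_mirror ?P"
      using less.hyps less.prems orthogonal_transformation_reflection
        orthogonal_transformation_compose by blast
    then have "id_or_mirror (reflection a 0 \<circ> ?P)"
      using a by (rule id_or_mirror_reflection[rotated])
    moreover have "reflection a 0 \<circ> ?P = Q"
      by (auto simp: fun_eq_iff)
    ultimately show ?thesis by simp
  qed
qed

lemma homeo_orthogonal: "orthogonal_transformation Q \<Longrightarrow> homeo Q"
  using orthogonal_id_or_mirror isotopic_homeo id_or_mirror_def by blast

section \<open>Similarities up to isotopy\<close>

definition similarity :: "(real^3 \<Rightarrow> real^3) \<Rightarrow> bool" where
  "similarity s \<longleftrightarrow> (\<exists>c>0. \<forall>x y. dist (s x) (s y) = c * dist x y)"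

text \<open>Subtracting \<open>s 0\<close> and dividing by the ratio \<open>c\<close> leaves an
  isometry that fixes the origin, and such a map is automatically linear.\<close>

lemma similarity_decomp:
  assumes "similarity s"
  obtains b c Q where "c > 0" "orthogonal_transformation Q" "s = (\<lambda>x. b + c *\<^sub>R Q x)"
proof -
  obtain c where c: "c > 0" "\<And>x y. dist (s x) (s y) = c * dist x y"
    using assms by (auto simp: similarity_def)
  define Q where "Q = (\<lambda>x. (1 / c) *\<^sub>R (s x - s 0))"
  have "dist (Q x) (Q y) = dist x y" for x y
    using c by (simp add: Q_def dist_norm flip: scaleR_diff_right)
  then have "orthogonal_transformation Q"
    by (simp add: orthogonal_transformation_isometry) (simp add: Q_def)
  then show thesis
    using c(1) by (intro that[of c Q "s 0"]) (auto simp: Q_def)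
qed

lemma similarity_id_or_mirror:
  assumes "similarity s"
  shows "id_or_mirror s"
proof -
  obtain b c Q where c: "c > 0" and Q: "orthogonal_transformation Q"
    and s: "s = (\<lambda>x. b + c *\<^sub>R Q x)"
    using similarity_decomp[OF assms] .
  \<comment> \<open>Translation and scaling are undone along a straight line: \<open>g t\<close>
    runs from the identity to \<open>x \<mapsto> b + c x\<close>. The ratio \<open>k t\<close> is a
    convex combination of 1 and \<open>c\<close>, hence positive, so each \<open>g t\<close> is
    invertible.\<close>
  define k where "k t = (1 - t) + t * c" for t
  define g where "g t x = t *\<^sub>R b + k t *\<^sub>R x" for t and x :: "real^3"
  have k: "k t > 0" if "t \<in> {0..1}" for t
    using that c unfolding k_def
    by (cases "t = 0") (auto intro!: add_nonneg_pos)
  have homeo_g: "homeo (g t)" if "t \<in> {0..1}" for t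
    unfolding homeomorphic_map_maps homeomorphic_maps_def
    by (rule exI[of _ "\<lambda>x. (1 / k t) *\<^sub>R (x - t *\<^sub>R b)"])
       (use k[OF that] in \<open>auto simp: g_def intro!: continuous_intros\<close>)
  have "isotopic (g 0) (g 1)"
    by (intro isotopicI homeo_g)
       (auto simp: g_def k_def case_prod_unfold intro!: continuous_intros)
  then have "isotopic (g 0 \<circ> Q) (g 1 \<circ> Q)"
    by (intro isotopic_comp_right homeo_orthogonal Q)
  moreover have "g 0 \<circ> Q = Q" "g 1 \<circ> Q = s"
    by (auto simp: g_def k_def s)
  ultimately have "isotopic s Q"
    using isotopic_sym by simp
  with orthogonal_id_or_mirror[OF Q] show ?thesis
    unfolding id_or_mirror_def using isotopic_trans by blast
qed

section \<open>Mirror images of knot types\<close>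

lemma mirror_type_knot_type: "mirror_type (knot_type K) = knot_type (mirror K)"
proof -
  have mm: "mir \<circ> mir = id" by (auto simp: fun_eq_iff)
  \<comment> \<open>Conjugation by \<open>mir\<close> turns an isotopy carrying \<open>K\<close> to
    \<open>L\<close> into one carrying the mirror images; as \<open>mirror\<close> is an involution,
    this also settles the converse inclusion below.\<close>
  have *: "ambient_isotopic (mirror K) (mirror L)" if "ambient_isotopic K L" for K L
  proof -
    obtain h where h: "isotopic id h" "h ` K = L"
      using \<open>ambient_isotopic K L\<close> unfolding ambient_isotopic_iff by blast
    have "isotopic (mir \<circ> (id \<circ> mir)) (mir \<circ> (h \<circ> mir))"
      by (intro isotopic_comp_left isotopic_comp_right h homeo_reflection)
    then have "isotopic id (mir \<circ> (h \<circ> mir))"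
      using mm by simp
    moreover have "(mir \<circ> (h \<circ> mir)) ` mirror K = mirror L"
      by (simp add: mirror_def image_image flip: h(2))
    ultimately show ?thesis
      unfolding ambient_isotopic_iff by blast
  qed
  have inv: "mirror (mirror L) = L" for L
    by (simp add: mirror_def image_comp mm)
  show ?thesis
  proof (intro set_eqI iffI)
    fix L assume "L \<in> knot_type (mirror K)"
    then have "mirror L \<in> knot_type K"
      using *[of "mirror K" L] by (simp add: knot_type_def inv)
    then show "L \<in> mirror_type (knot_type K)"
      unfolding mirror_type_def using inv[of L] by (intro image_eqI[of _ _ "mirror L"]) simp_all
  next
    fix L assume "L \<in> mirror_type (knot_type K)"
    then show "L \<in> knot_type (mirror K)"
      unfolding mirror_type_def knot_type_def using * by blast
  qed
qed

lemma knot_type_similarity_image: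
  assumes "similarity s"
  shows "knot_type (s ` K) = knot_type K \<or> knot_type (s ` K) = mirror_type (knot_type K)"
proof -
  consider "isotopic s id" | "isotopic s mir"
    using similarity_id_or_mirror[OF assms] unfolding id_or_mirror_def by blast
  then show ?thesis
  proof cases
    case 1
    from knot_type_image[OF this] show ?thesis by simp
  next
    case 2
    from knot_type_image[OF this] show ?thesis
      by (simp add: mirror_type_knot_type mirror_def)
  qed
qed

lemma similarity_reflection: "similarity (reflection a b)"
  by (auto simp: similarity_def dist_reflection intro!: exI[of _ 1])

section \<open>Images of polygons\<close>

lemma inj_similarity: "similarity s \<Longrightarrow> inj s"
  unfolding similarity_def inj_def by (metis dist_eq_0_iff mult_eq_0_iff less_irrefl)

lemma similarity_closed_segment:
  assumes "similarity s"
  shows "s ` closed_segment x y = closed_segment (s x) (s y)"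
proof -
  obtain b c Q where c: "c > 0" and Q: "orthogonal_transformation Q"
    and s: "s = (\<lambda>x. b + c *\<^sub>R Q x)"
    using similarity_decomp[OF assms] .
  have "linear (\<lambda>x. c *\<^sub>R Q x)"
    using Q by (simp add: orthogonal_transformation_def linear_compose_scale_right)
  then have "closed_segment (c *\<^sub>R Q x) (c *\<^sub>R Q y) = (\<lambda>x. c *\<^sub>R Q x) ` closed_segment x y"
    by (rule closed_segment_linear_image)
  then have "closed_segment (b + c *\<^sub>R Q x) (b + c *\<^sub>R Q y)
      = (\<lambda>x. b + c *\<^sub>R Q x) ` closed_segment x y"
    by (simp add: closed_segment_translation image_image)
  then show ?thesis
    by (simp add: s)
qed

lemma polygon_edge_map:
  assumes "similarity s" "i < length vs"
  shows "polygon_edge (map s vs) i = s ` polygon_edge vs i"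
proof -
  \<comment> \<open>The cyclic successor is a valid index, so \<open>map\<close> may be evaluated at
    both ends of the edge.\<close>
  have "Suc i mod length vs < length vs"
    using assms by (intro mod_less_divisor) auto
  then show ?thesis
    using assms by (simp add: polygon_edge_def similarity_closed_segment)
qed

lemma polygon_map: "similarity s \<Longrightarrow> polygon (map s vs) = s ` polygon vs"
  by (auto simp: polygon_def polygon_edge_map)

text \<open>Embeddedness is expressed by equalities between intersections of edges and of vertex
  sets; an injective map commutes with intersections and both preserves and reflects equality of
  sets.\<close>

lemma embedded_polygon_map:
  assumes "similarity s"
  shows "embedded_polygon (map s vs) \<longleftrightarrow> embedded_polygon vs"
proof -
  have inj: "inj s" using assms by (rule inj_similarity)
  have edges: "(polygon_edge (map s vs) i \<inter> polygon_edge (map s vs) j =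
        {map s vs ! i, map s vs ! (Suc i mod length vs)} \<inter> {map s vs ! j, map s vs ! (Suc j mod length vs)})
    \<longleftrightarrow> (polygon_edge vs i \<inter> polygon_edge vs j =
        {vs ! i, vs ! (Suc i mod length vs)} \<inter> {vs ! j, vs ! (Suc j mod length vs)})"
    (is "?L = ?R") if "i < length vs" "j < length vs" for i j
  proof -
    have "Suc i mod length vs < length vs" "Suc j mod length vs < length vs"
      using that by (auto intro!: mod_less_divisor)
    then have "?L \<longleftrightarrow> s ` (polygon_edge vs i \<inter> polygon_edge vs j) =
        s ` ({vs ! i, vs ! (Suc i mod length vs)} \<inter> {vs ! j, vs ! (Suc j mod length vs)})"
      using that unfolding image_Int[OF inj] by (simp add: polygon_edge_map[OF assms])
    also have "\<dots> \<longleftrightarrow> ?R"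
      by (rule inj_image_eq_iff[OF inj])
    finally show ?thesis .
  qed
  have "distinct (map s vs) \<longleftrightarrow> distinct vs"
    using inj by (metis distinct_map inj_on_subset subset_UNIV)
  then show ?thesis
    unfolding embedded_polygon_def length_map
    by (intro conj_cong all_cong1 imp_cong refl edges)
qed

section \<open>Moebius transformations\<close>

text \<open>Completed by \<open>qdist \<infinity> x = 1\<close>, the distance is multiplied by a factor \<open>w a * w b\<close> under
  every Moebius transformation (as the inner product of light vectors is).\<close>

fun qdist :: "(real^3) option \<Rightarrow> (real^3) option \<Rightarrow> real" where
  "qdist (Some x) (Some y) = dist x y"
| "qdist None None = 0"
| "qdist _ _ = 1"

definition conformal :: "((real^3) option \<Rightarrow> (real^3) option) \<Rightarrow> bool" where
  "conformal \<mu> \<longleftrightarrow> (\<exists>w. (\<forall>a. w a > 0) \<and> (\<forall>a b. qdist (\<mu> a) (\<mu> b) = w a * w b * qdist a b))"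

lemma conformal_comp:
  assumes "conformal \<mu>" "conformal \<nu>"
  shows "conformal (\<mu> \<circ> \<nu>)"
proof -
  obtain u v where "\<forall>a. u a > 0" "\<forall>a b. qdist (\<mu> a) (\<mu> b) = u a * u b * qdist a b"
    "\<forall>a. v a > 0" "\<forall>a b. qdist (\<nu> a) (\<nu> b) = v a * v b * qdist a b"
    using assms by (auto simp: conformal_def)
  then show ?thesis
    \<comment> \<open>The weights satisfy a chain rule: that of the outer map is taken at the image
      point.\<close>
    unfolding conformal_def by (intro exI[of _ "\<lambda>a. u (\<nu> a) * v a"]) auto
qed

text \<open>Expanding the squared distance gives \<open>k\<^sup>2\<close> times 1/|x|^2 - 2 (x
  \<bullet> y)/(|x|^2 |y|^2) + 1/|y|^2, which is |x - y|^2 over |x|^2 |y|^2.\<close>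

lemma dist_inversion:
  fixes x y :: "'a::real_inner"
  assumes "x \<noteq> 0" "y \<noteq> 0"
  shows "dist ((k / (norm x)\<^sup>2) *\<^sub>R x) ((k / (norm y)\<^sup>2) *\<^sub>R y)
    = \<bar>k\<bar> / (norm x * norm y) * dist x y"
proof -
  have "(dist ((k / (norm x)\<^sup>2) *\<^sub>R x) ((k / (norm y)\<^sup>2) *\<^sub>R y))\<^sup>2
      = (\<bar>k\<bar> / (norm x * norm y) * dist x y)\<^sup>2"
  proof -
    have "x \<bullet> x \<noteq> 0" "y \<bullet> y \<noteq> 0"
      using assms by simp_all
    then show ?thesis
      unfolding dist_norm power_mult_distrib power_divide power2_abs power2_norm_eq_inner
      by (simp add: inner_diff_left inner_diff_right inner_commute[of y x])
         (simp add: field_simps power2_eq_square)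
  qed
  then show ?thesis
    by (rule power2_eq_imp_eq) auto
qed

lemma conformal_sphere_inversion:
  assumes "r > 0"
  shows "conformal (sphere_inversion p r)"
proof -
  \<comment> \<open>For finite points other than \<open>p\<close> this is the factor in
    \<open>dist_inversion\<close>. Pairing infinity with such a point forces the value
    \<open>r\<close> there, and pairing \<open>p\<close> with such a point forces
    \<open>1 / r\<close>.\<close>
  define w where "w a = (case a of None \<Rightarrow> r | Some x \<Rightarrow> if x = p then 1 / r else r / norm (x - p))"
    for a :: "(real^3) option"
  have w: "w a > 0" for a
    using assms by (auto simp: w_def split: option.split)
  have "qdist (sphere_inversion p r a) (sphere_inversion p r b) = w a * w b * qdist a b" for a b
  proof (cases a; cases b)
    fix x y assume ab: "a = Some x" "b = Some y"
    show ?thesis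
    proof (cases "x = p \<or> y = p")
      case True
      then show ?thesis
        using assms ab by (auto simp: w_def sphere_inversion_def dist_norm norm_minus_commute)
    next
      case False
      then show ?thesis
        using assms ab dist_inversion[of "x - p" "y - p" "r\<^sup>2"]
        by (simp add: w_def sphere_inversion_def power2_eq_square dist_norm)
    qed
  qed (use assms in \<open>auto simp: w_def sphere_inversion_def dist_norm power2_eq_square\<close>)
  with w show ?thesis
    unfolding conformal_def by blast
qed

lemma conformal_plane_inversion: "conformal (plane_inversion a b)"
proof -
  have "qdist (plane_inversion a b y) (plane_inversion a b z) = qdist y z" for y z
    by (cases y; cases z) (auto simp: plane_inversion_def dist_reflection)
  then show ?thesis
    unfolding conformal_def by (intro exI[of _ "\<lambda>_. 1"]) auto
qed

lemma conformal_moebius: "is_moebius \<mu> \<Longrightarrow> conformal \<mu>"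
proof (induction rule: is_moebius.induct)
  case moebius_id
  show ?case by (auto simp: conformal_def intro!: exI[of _ "\<lambda>_. 1"])
next
  case (moebius_comp \<rho> \<mu>)
  then have "conformal \<rho>"
    using conformal_sphere_inversion conformal_plane_inversion by (auto simp: is_inversion_def)
  with moebius_comp show ?case
    by (intro conformal_comp)
qed

text \<open>All finite points are at \<open>qdist\<close> 1 from infinity, before and after the map.
  So they all have the same weight, the reciprocal of that of infinity, and distances are scaled by
  a constant.\<close>

lemma conformal_fixing_infinity:
  assumes "conformal \<mu>" "\<mu> None = None"
  obtains s where "similarity s" "\<mu> = map_option s"
proof -
  obtain w where w: "\<And>a. w a > 0" "\<And>a b. qdist (\<mu> a) (\<mu> b) = w a * w b * qdist a b"
    using assms by (auto simp: conformal_def)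
  define s where "s x = the (\<mu> (Some x))" for x
  \<comment> \<open>A finite point cannot go to infinity: its \<open>qdist\<close> to infinity would
    drop to 0, but positive weights keep it positive.\<close>
  have \<mu>: "\<mu> (Some x) = Some (s x)" for x
    using w(2)[of None "Some x"] w(1)[of None] w(1)[of "Some x"] assms(2)
    by (cases "\<mu> (Some x)") (auto simp: s_def)
  have one: "w None * w (Some x) = 1" for x
    using w(2)[of None "Some x"] assms(2) by (simp add: \<mu>)
  then have "w (Some x) = 1 / w None" for x
    using w(1)[of None] by (simp add: field_simps)
  then have "dist (s x) (s y) = (1 / w None)\<^sup>2 * dist x y" for x y
    using w(2)[of "Some x" "Some y"] by (simp add: \<mu> power2_eq_square)
  then have "similarity s"
    unfolding similarity_def using w(1)[of None] by (intro exI[of _ "(1 / w None)\<^sup>2"]) auto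
  moreover have "\<mu> a = map_option s a" for a
    by (cases a) (auto simp: \<mu> assms(2))
  ultimately show thesis
    using that by blast
qed

section \<open>Normal form of Moebius transformations\<close>

lemma sphere_inversion_involution:
  assumes "r > 0"
  shows "sphere_inversion p r (sphere_inversion p r a) = a"
proof (cases a)
  case (Some x)
  \<comment> \<open>With \<open>n\<close> the distance of \<open>x\<close> from \<open>p\<close>,
    the image is at distance \<open>r\<^sup>2 / n\<close>; the scaling factors of the two inversions
    cancel.\<close>
  have "(r\<^sup>2 / (r\<^sup>2 / n\<^sup>2 * n)\<^sup>2) * (r\<^sup>2 / n\<^sup>2) = 1" if "n > 0" for n
    using assms that by (simp add: field_simps power2_eq_square)
  from this[of "norm (x - p)"] show ?thesis
    using assms by (cases "x = p") (simp_all add: Some sphere_inversion_def)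
qed (simp add: sphere_inversion_def)

lemma surj_inversion: "is_inversion \<rho> \<Longrightarrow> surj \<rho>"
proof (rule surjI[of \<rho> \<rho>])
  fix a assume "is_inversion \<rho>"
  then show "\<rho> (\<rho> a) = a"
    by (auto simp: is_inversion_def sphere_inversion_involution plane_inversion_def
        option.map_comp o_def option.map_ident)
qed

lemma surj_moebius: "is_moebius \<mu> \<Longrightarrow> surj \<mu>"
  by (induction rule: is_moebius.induct) (simp, metis comp_surj surj_inversion)

lemma moebius_decomp:
  assumes "is_moebius \<mu>"
  obtains s where "similarity s" "\<mu> = map_option s"
  | s p where "similarity s" "\<mu> = map_option s \<circ> sphere_inversion p 1"
proof -
  obtain a where a: "\<mu> a = None"
    using surj_moebius[OF assms] by (metis surjD)
  show thesis
  proof (cases a)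
    case None
    then show ?thesis
      using conformal_fixing_infinity[OF conformal_moebius[OF assms]] a that(1) by metis
  next
    case (Some p)
    \<comment> \<open>This inversion takes infinity to \<open>p\<close>, which \<open>\<mu>\<close>
      returns to infinity. Another radius would only change the similarity by a scaling about
      \<open>p\<close>.\<close>
    let ?\<rho> = "sphere_inversion p 1"
    have "conformal (\<mu> \<circ> ?\<rho>)"
      by (intro conformal_comp conformal_moebius assms conformal_sphere_inversion) simp
    moreover have "(\<mu> \<circ> ?\<rho>) None = None"
      using a Some by (simp add: sphere_inversion_def)
    ultimately obtain s where s: "similarity s" "\<mu> \<circ> ?\<rho> = map_option s"
      by (rule conformal_fixing_infinity)
    have "\<mu> = (\<mu> \<circ> ?\<rho>) \<circ> ?\<rho>"
      by (simp add: fun_eq_iff sphere_inversion_involution)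
    with s show ?thesis
      using that(2) by metis
  qed
qed

section \<open>Knot types of the transformed polygons\<close>

lemma hat_map_option_comp:
  assumes "no_vertex_to_infinity \<mu> vs"
  shows "hat (map_option s \<circ> \<mu>) vs = map s (hat \<mu> vs)"
  \<comment> \<open>\<open>the\<close> can be moved past \<open>map_option s\<close> at
    \<open>Some\<close> values, and the hypothesis ensures that only these occur.\<close>
  using assms by (auto simp: hat_def no_vertex_to_infinity_def option.map_sel)

lemma inversion_types_knot_type:
  assumes "is_inversion \<rho>" "inversion_center \<rho> \<notin> Some ` set vs" "embedded_polygon (hat \<rho> vs)"
  shows "knot_type (polygon (hat \<rho> vs)) \<in> inversion_types vs"
  unfolding inversion_types_def using assms by blast

lemma is_inversion_mir: "is_inversion (plane_inversion (axis 3 1) 0)"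
  unfolding is_inversion_def by (metis axis_eq_0_iff zero_neq_one)

lemma moebius_type_cases:
  assumes K: "embedded_polygon vs" and T: "T \<in> moebius_types vs"
  shows "T \<in> inversion_types vs \<or> (\<exists>T'\<in>inversion_types vs. T = mirror_type T')"
proof -
  obtain \<mu> where \<mu>: "is_moebius \<mu>" "no_vertex_to_infinity \<mu> vs" "embedded_polygon (hat \<mu> vs)"
    and T: "T = knot_type (polygon (hat \<mu> vs))"
    using T by (auto simp: moebius_types_def)
  from \<mu>(1) show ?thesis
  proof (cases rule: moebius_decomp)
    case (1 s)
    \<comment> \<open>The identity is not an inversion, so the type of the knot itself is obtained
      as the mirror image of the type that this reflection contributes to
      \<open>inversion_types vs\<close>.\<close>
    let ?m = "plane_inversion (axis 3 1) 0"
    have hat: "hat (map_option f) vs = map f vs" for f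
      by (simp add: hat_def)
    have "knot_type (polygon (hat ?m vs)) \<in> inversion_types vs"
    proof (rule inversion_types_knot_type[OF is_inversion_mir])
      show "embedded_polygon (hat ?m vs)"
        using K by (simp add: plane_inversion_def hat embedded_polygon_map similarity_reflection)
    qed (auto simp: inversion_center_def plane_inversion_def)
    moreover have "knot_type (polygon (hat ?m vs)) = knot_type (mirror (polygon vs))"
      by (simp add: plane_inversion_def hat polygon_map similarity_reflection mirror_def)
    ultimately have A: "knot_type (mirror (polygon vs)) \<in> inversion_types vs"
      by simp
    have "T = knot_type (polygon vs) \<or> T = knot_type (mirror (polygon vs))"
      using knot_type_similarity_image[OF 1(1)] 1
      by (simp add: T hat polygon_map mirror_type_knot_type)
    moreover have "mirror_type (knot_type (mirror (polygon vs))) = knot_type (polygon vs)"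
      by (simp add: mirror_type_knot_type) (simp add: mirror_def image_image)
    ultimately show ?thesis
      using A by metis
  next
    case (2 s p)
    let ?\<rho> = "sphere_inversion p 1"
    \<comment> \<open>\<open>map_option s\<close> neither creates nor removes \<open>None\<close>,
      so \<open>?\<rho>\<close> and \<open>\<mu>\<close> send the same points to infinity.\<close>
    have nv: "no_vertex_to_infinity ?\<rho> vs"
      using \<mu>(2) by (simp add: 2 no_vertex_to_infinity_def)
    then have hat: "hat \<mu> vs = map s (hat ?\<rho> vs)"
      unfolding 2 by (rule hat_map_option_comp)
    have "knot_type (polygon (hat ?\<rho> vs)) \<in> inversion_types vs"
    proof (rule inversion_types_knot_type)
      show "is_inversion ?\<rho>"
        unfolding is_inversion_def by (metis zero_less_one)
      show "inversion_center ?\<rho> \<notin> Some ` set vs"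
        using nv by (auto simp: inversion_center_def sphere_inversion_def no_vertex_to_infinity_def)
      show "embedded_polygon (hat ?\<rho> vs)"
        using \<mu>(3) by (simp add: hat embedded_polygon_map 2(1))
    qed
    then show ?thesis
      using knot_type_similarity_image[OF 2(1), of "polygon (hat ?\<rho> vs)"]
      by (auto simp: T hat polygon_map 2(1))
  qed
qed

lemma no_vertex_to_infinity_inversion:
  assumes "is_inversion \<rho>" "inversion_center \<rho> \<notin> Some ` set vs"
  shows "no_vertex_to_infinity \<rho> vs"
  using assms
  by (auto simp: is_inversion_def inversion_center_def sphere_inversion_def plane_inversion_def
      no_vertex_to_infinity_def)

text \<open>The bound by twice the cardinality, in a form valid for infinite sets too: two copies of
  \<open>A\<close> map onto a superset of \<open>M\<close>, the first by the identity and the second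
  by \<open>f\<close>.\<close>

lemma lepoll_two_copies:
  assumes "\<And>T. T \<in> M \<Longrightarrow> T \<in> A \<or> (\<exists>T'\<in>A. T = f T')"
  shows "M \<lesssim> {..<2::nat} \<times> A"
proof -
  define g where "g z = (if fst z = (0::nat) then snd z else f (snd z))" for z
  have "T \<in> g ` ({..<2} \<times> A)" if "T \<in> M" for T
    using assms[OF that]
  proof (elim disjE bexE)
    show ?thesis if "T \<in> A"
      using that by (intro image_eqI[of _ _ "(0, T)"]) (auto simp: g_def)
    show ?thesis if "T' \<in> A" "T = f T'" for T'
      using that by (intro image_eqI[of _ _ "(1, T')"]) (auto simp: g_def)
  qed
  then show ?thesis
    by (meson image_lepoll lepoll_trans subset_imp_lepoll subsetI)
qed

theorem theorem8:
  fixes vs :: "(real^3) list"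
  assumes "embedded_polygon vs"
  shows "moebius_types vs \<lesssim> {..<2::nat} \<times> inversion_types vs
    \<and> (\<forall>\<rho>. is_inversion \<rho> \<and> inversion_center \<rho> \<notin> Some ` set vs \<and> embedded_polygon (hat \<rho> vs) \<longrightarrow>
         (\<exists>\<sigma>. is_inversion \<sigma> \<and> no_vertex_to_infinity (\<sigma> \<circ> \<rho>) vs \<and>
              embedded_polygon (hat (\<sigma> \<circ> \<rho>) vs) \<and>
              knot_type (polygon (hat (\<sigma> \<circ> \<rho>) vs)) = knot_type (mirror (polygon (hat \<rho> vs)))))
    \<and> (\<forall>T\<in>moebius_types vs.
         T \<in> inversion_types vs \<or> (\<exists>T'\<in>inversion_types vs. T = mirror_type T'))"
proof (intro conjI allI impI ballI)
  show "moebius_types vs \<lesssim> {..<2::nat} \<times> inversion_types vs"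
    by (rule lepoll_two_copies[OF moebius_type_cases[OF assms]])
next
  fix \<rho>
  assume \<rho>: "is_inversion \<rho> \<and> inversion_center \<rho> \<notin> Some ` set vs \<and> embedded_polygon (hat \<rho> vs)"
  \<comment> \<open>Reflecting in the very plane that defines \<open>mirror\<close> makes the new
    polygon equal to the mirror image as a point set, not merely isotopic to it.\<close>
  let ?\<sigma> = "plane_inversion (axis 3 1) 0"
  have nv: "no_vertex_to_infinity \<rho> vs"
    using \<rho> by (intro no_vertex_to_infinity_inversion) auto
  have hat: "hat (?\<sigma> \<circ> \<rho>) vs = map mir (hat \<rho> vs)"
    unfolding plane_inversion_def by (rule hat_map_option_comp[OF nv])
  have "no_vertex_to_infinity (?\<sigma> \<circ> \<rho>) vs"
    using nv by (simp add: no_vertex_to_infinity_def plane_inversion_def)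
  moreover have "embedded_polygon (hat (?\<sigma> \<circ> \<rho>) vs)"
    using \<rho> by (simp add: hat embedded_polygon_map similarity_reflection)
  moreover have "polygon (hat (?\<sigma> \<circ> \<rho>) vs) = mirror (polygon (hat \<rho> vs))"
    by (simp add: hat polygon_map similarity_reflection mirror_def)
  ultimately show "\<exists>\<sigma>. is_inversion \<sigma> \<and> no_vertex_to_infinity (\<sigma> \<circ> \<rho>) vs \<and>
      embedded_polygon (hat (\<sigma> \<circ> \<rho>) vs) \<and>
      knot_type (polygon (hat (\<sigma> \<circ> \<rho>) vs)) = knot_type (mirror (polygon (hat \<rho> vs)))"
    using is_inversion_mir by metis
next
  fix T assume "T \<in> moebius_types vs"
  then show "T \<in> inversion_types vs \<or> (\<exists>T'\<in>inversion_types vs. T = mirror_type T')"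
    by (rule moebius_type_cases[OF assms])
qed

end
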